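(* Let $E$ and $F$ be Banach spaces over $\mathbb{K}$, and let $\mathcal{F}=((a_m,b_m^* ))_{m\in\mathbb{N}^*}\subset E\times E^*$ and $\mathcal{G}=((x_n,y_n^* ))_{n\in\mathbb{N}^*}\subset F\times F^*$ be unconditional Schauder bases (USBs) for $E$ and $F$, respectively. Let $\alpha_{\mathcal{F},\mathcal{G}}^{Bess}$ be the Besselian crossnorm on $E\otimes F$ associated with $\mathcal{F}$ and $\mathcal{G}$. Then the tensor product sequence $$\mathcal{F}\otimes\mathcal{G}=\left((a_m\otimes x_n,\; b_m^*\otimes y_n^* )\right)_{m,n\in\mathbb{N}^*},$$ ordered in the square ordering, forms an unconditional Schauder basis for the completion $E\otimes_{\alpha_{\mathcal{F},\mathcal{G}}^{Bess}}F$.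
   Context: $\mathbb{K}=\mathbb{R}$ or $\mathbb{C}$; $\mathbb{N}^*=\{1,2,3,\dots\}$; $E^*$ is the topological dual of $E$; $E\otimes F$ is the algebraic tensor product. A sequence $(a_m)_{m\in\mathbb{N}^*}\subset E$ is a Schauder basis for $E$ if every $x\in E$ has a unique expansion $x=\sum_{m=1}^\infty\lambda_m a_m$ with scalars $\lambda_m$ (norm convergence); it is an unconditional Schauder basis (USB) if moreover this series converges unconditionally for every $x\in E$. The coefficient functionals $b_m^*\in E^*$, defined by $x=\sum_m b_m^*(x)a_m$, are continuous and satisfy $b_i^*(a_j)=\delta_{i,j}$. A sequence of pairs $((a_m,b_m^* ))_m\subset E\times E^*$ is called a USB for $E$ if $(a_m)$ is a USB for $E$ with coefficient functionals $(b_m^* )$; similarly for other spaces. Besselian crossnorm: for a finite sum of elementary tensors put $$Bess\Big(\sum_{r=1}^R x^r\otimes y^r\Big):=\sup_{\|f^*\|_{E^*}\le 1,\ \|g^*\|_{F^*}\le 1}\ \sum_{r=1}^R\sum_{m,n=1}^\infty\left|b_m^*(x^r)\,y_n^*(y^r)\,f^*(a_m)\,g^*(x_n)\right|,$$ and for $u\in E\otimes F$ put $$\alpha_{\mathcal{F},\mathcal{G}}^{Bess}(u):=\inf\Big\{Bess\Big(\sum_{r=1}^R x^r\otimes y^r\Big): u=\sum_{r=1}^R x^r\otimes y^r\Big\},$$ the infimum over all finite representations of $u$ in $E\otimes F$. This is a norm on $E\otimes F$, and $E\otimes_{\alpha_{\mathcal{F},\mathcal{G}}^{Bess}}F$ denotes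 the completion of $E\otimes F$ with respect to it. For $f^*\in E^*$, $g^*\in F^*$, the functional $f^*\otimes g^*$ on $E\otimes F$ is $\sum_r x^r\otimes y^r\mapsto\sum_r f^*(x^r)g^*(y^r)$; it is continuous for $\alpha_{\mathcal{F},\mathcal{G}}^{Bess}$ and is extended by continuity to the completion. Square ordering of $\mathbb{N}^*\times\mathbb{N}^*$: the enumeration $(1,1),(1,2),(2,2),(2,1),(1,3),(2,3),(3,3),(3,2),(3,1),\dots$, i.e. for each $N\geq 1$ the square $\{1,\dots,N\}^2$ is exhausted before any index outside it, the pairs with $\max(m,n)=N$ being listed as $(1,N),(2,N),\dots,(N,N),(N,N-1),\dots,(N,1)$. *)

theory Defs
  imports "HOL-Analysis.Analysis" "HOL-Library.Discrete_Functions"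
begin

(* The scalar field is a type of sort {real_normed_field, euclidean_space}: a finite-dimensional
   normed field extension of the reals with multiplicative norm. By Frobenius, the types of this
   sort are, up to isometric isomorphism, exactly the real and the complex numbers.
   Since the class real_normed_vector only provides real scalars, the scalar multiplication is an
   explicit parameter; for 'k = real it is forced to be scaleR. *)

locale normed_space_over = vector_space smul
  for smul :: "'k::{real_normed_field,euclidean_space} \<Rightarrow> 'a::real_normed_vector \<Rightarrow> 'a" +
  assumes smul_of_real: "smul (of_real r) x = r *\<^sub>R x"
    and norm_smul: "norm (smul c x) = norm c * norm x"

lemma normed_space_over_real: "normed_space_over (scaleR :: real \<Rightarrow> 'a::real_normed_vector \<Rightarrow> 'a)"
  by unfold_locales (simp_all add: algebra_simps)

lemma normed_space_over_complex: "normed_space_over ((*) :: complex \<Rightarrow> complex \<Rightarrow> complex)"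
  by unfold_locales (simp_all add: algebra_simps norm_mult scaleR_conv_of_real)

definition dual :: "('k::{real_normed_field,euclidean_space} \<Rightarrow> 'a::real_normed_vector \<Rightarrow> 'a) \<Rightarrow> ('a \<Rightarrow> 'k) set"
  where "dual smul = {f. bounded_linear f \<and> (\<forall>c x. f (smul c x) = c * f x)}"

definition dual_ball :: "('k::{real_normed_field,euclidean_space} \<Rightarrow> 'a::real_normed_vector \<Rightarrow> 'a) \<Rightarrow> ('a \<Rightarrow> 'k) set"
  where "dual_ball smul = {f \<in> dual smul. onorm f \<le> 1}"


(* Sequences indexed by 1, 2, 3, ... are represented as functions on nat, starting at 0. *)

definition schauder_basis ::
  "('k::{real_normed_field,euclidean_space} \<Rightarrow> 'a::real_normed_vector \<Rightarrow> 'a) \<Rightarrow> (nat \<Rightarrow> 'a) \<Rightarrow> bool"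
  where "schauder_basis smul a \<longleftrightarrow> (\<forall>x. \<exists>!l. (\<lambda>m. smul (l m) (a m)) sums x)"

definition unconditionally_convergent :: "(nat \<Rightarrow> 'a::real_normed_vector) \<Rightarrow> bool"
  where "unconditionally_convergent f \<longleftrightarrow> (\<forall>p. bij p \<longrightarrow> summable (\<lambda>m. f (p m)))"

definition unconditional_schauder_basis ::
  "('k::{real_normed_field,euclidean_space} \<Rightarrow> 'a::real_normed_vector \<Rightarrow> 'a) \<Rightarrow> (nat \<Rightarrow> 'a) \<Rightarrow> bool"
  where "unconditional_schauder_basis smul a \<longleftrightarrow> schauder_basis smul a \<and>
    (\<forall>x l. (\<lambda>m. smul (l m) (a m)) sums x \<longrightarrow> unconditionally_convergent (\<lambda>m. smul (l m) (a m)))"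

definition USB ::
  "('k::{real_normed_field,euclidean_space} \<Rightarrow> 'a::real_normed_vector \<Rightarrow> 'a) \<Rightarrow>
    (nat \<Rightarrow> 'a) \<Rightarrow> (nat \<Rightarrow> 'a \<Rightarrow> 'k) \<Rightarrow> bool"
  where "USB smul a b \<longleftrightarrow> unconditional_schauder_basis smul a \<and>
    (\<forall>m. b m \<in> dual smul) \<and> (\<forall>x. (\<lambda>m. smul (b m x) (a m)) sums x)"


(* The algebraic tensor product, constructed as the space of functionals on the bilinear forms
   that is spanned by the evaluations at pairs (x, y). A functional is extended by 0 to functions
   that are not bilinear; addition and scalar multiplication are pointwise. Every element is a
   finite sum of elementary tensors, as scalars can be absorbed into the first factor. *)

definition bilinear_form ::
  "('k::field \<Rightarrow> 'a::ab_group_add \<Rightarrow> 'a) \<Rightarrow> ('k \<Rightarrow> 'b::ab_group_add \<Rightarrow> 'b) \<Rightarrow> ('a \<Rightarrow> 'b \<Rightarrow> 'k) \<Rightarrow> bool"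
  where "bilinear_form sE sF B \<longleftrightarrow>
    (\<forall>y. Vector_Spaces.linear sE (*) (\<lambda>x. B x y)) \<and> (\<forall>x. Vector_Spaces.linear sF (*) (\<lambda>y. B x y))"

type_synonym ('k, 'a, 'b) tensor = "('a \<Rightarrow> 'b \<Rightarrow> 'k) \<Rightarrow> 'k"

definition elem_tensor ::
  "('k::field \<Rightarrow> 'a::ab_group_add \<Rightarrow> 'a) \<Rightarrow> ('k \<Rightarrow> 'b::ab_group_add \<Rightarrow> 'b) \<Rightarrow> 'a \<Rightarrow> 'b \<Rightarrow> ('k, 'a, 'b) tensor"
  where "elem_tensor sE sF x y = (\<lambda>B. if bilinear_form sE sF B then B x y else 0)"

definition tensor_sum ::
  "('k::field \<Rightarrow> 'a::ab_group_add \<Rightarrow> 'a) \<Rightarrow> ('k \<Rightarrow> 'b::ab_group_add \<Rightarrow> 'b) \<Rightarrow> ('a \<times> 'b) list \<Rightarrow> ('k, 'a, 'b) tensor"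
  where "tensor_sum sE sF ps = (\<lambda>B. \<Sum>(x, y)\<leftarrow>ps. elem_tensor sE sF x y B)"

definition tensor_product ::
  "('k::field \<Rightarrow> 'a::ab_group_add \<Rightarrow> 'a) \<Rightarrow> ('k \<Rightarrow> 'b::ab_group_add \<Rightarrow> 'b) \<Rightarrow> ('k, 'a, 'b) tensor set"
  where "tensor_product sE sF = range (tensor_sum sE sF)"

lemma tensor_sum_Nil [simp]: "tensor_sum sE sF [] = (\<lambda>B. 0)"
  by (simp add: tensor_sum_def)

lemma tensor_sum_append:
  "tensor_sum sE sF (ps @ qs) = (\<lambda>B. tensor_sum sE sF ps B + tensor_sum sE sF qs B)"
  by (simp add: tensor_sum_def)

lemma elem_tensor_in_tensor_product: "elem_tensor sE sF x y \<in> tensor_product sE sF"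
  unfolding tensor_product_def
  by (rule range_eqI[where x = "[(x, y)]"]) (simp add: tensor_sum_def)

lemma elem_tensor_add_left:
  "elem_tensor sE sF (x + x') y = (\<lambda>B. elem_tensor sE sF x y B + elem_tensor sE sF x' y B)"
  by (auto simp: elem_tensor_def bilinear_form_def fun_eq_iff Vector_Spaces.linear_iff)

lemma elem_tensor_add_right:
  "elem_tensor sE sF x (y + y') = (\<lambda>B. elem_tensor sE sF x y B + elem_tensor sE sF x y' B)"
  by (auto simp: elem_tensor_def bilinear_form_def fun_eq_iff Vector_Spaces.linear_iff)

lemma elem_tensor_scale_left:
  "elem_tensor sE sF (sE c x) y = (\<lambda>B. c * elem_tensor sE sF x y B)"
  by (auto simp: elem_tensor_def bilinear_form_def fun_eq_iff Vector_Spaces.linear_iff)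

lemma elem_tensor_scale_right:
  "elem_tensor sE sF x (sF c y) = (\<lambda>B. c * elem_tensor sE sF x y B)"
  by (auto simp: elem_tensor_def bilinear_form_def fun_eq_iff Vector_Spaces.linear_iff)

(* Universal property: a bilinear map into any vector space factors through the tensor product.
   This is its well-definedness part; linearity of the factor is immediate on representations. *)

lemma tensor_sum_universal:
  fixes sE :: "'k::field \<Rightarrow> 'a::ab_group_add \<Rightarrow> 'a" and sF :: "'k \<Rightarrow> 'b::ab_group_add \<Rightarrow> 'b"
    and sG :: "'k \<Rightarrow> 'c::ab_group_add \<Rightarrow> 'c"
  assumes B1: "\<And>y. Vector_Spaces.linear sE sG (\<lambda>x. B x y)"
    and B2: "\<And>x. Vector_Spaces.linear sF sG (\<lambda>y. B x y)"
    and eq: "tensor_sum sE sF ps = tensor_sum sE sF qs"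
  shows "(\<Sum>(x, y)\<leftarrow>ps. B x y) = (\<Sum>(x, y)\<leftarrow>qs. B x y)"
proof (rule ccontr)
  let ?z = "(\<Sum>(x, y)\<leftarrow>ps. B x y) - (\<Sum>(x, y)\<leftarrow>qs. B x y)"
  assume "\<not> ?thesis"
  then have z: "?z \<noteq> 0" by simp
  interpret G: vector_space sG
    using B1[of 0] by (simp add: Vector_Spaces.linear_iff)
  interpret GK: vector_space_pair sG "(*) :: 'k \<Rightarrow> 'k \<Rightarrow> 'k"
    by unfold_locales (simp_all add: algebra_simps)
  have "G.independent {?z}" using z by (simp add: G.dependent_single)
  from GK.linear_independent_extend[OF this, of "\<lambda>_. 1"]
  obtain g where g: "Vector_Spaces.linear sG (*) g" "g ?z = 1" by auto
  interpret g: Vector_Spaces.linear sG "(*)" g by (rule g)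
  have bil: "bilinear_form sE sF (\<lambda>x y. g (B x y))"
    unfolding bilinear_form_def
    using Vector_Spaces.linear_compose[OF B1 g(1)] Vector_Spaces.linear_compose[OF B2 g(1)]
    by (simp add: o_def)
  have *: "tensor_sum sE sF rs (\<lambda>x y. g (B x y)) = g (\<Sum>(x, y)\<leftarrow>rs. B x y)" for rs
    by (induction rs) (auto simp: tensor_sum_def elem_tensor_def bil g.add)
  have "g ?z = 0" using eq by (simp add: g.diff *[symmetric])
  with g(2) show False by simp
qed


(* The functional f \<otimes> g on the tensor product is evaluation at the bilinear form
   (x, y) \<mapsto> f x * g y; see functional_tensor_sum for its values on representations. *)

definition functional_tensor :: "('a \<Rightarrow> 'k::times) \<Rightarrow> ('b \<Rightarrow> 'k) \<Rightarrow> ('k, 'a, 'b) tensor \<Rightarrow> 'k"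
  where "functional_tensor f g u = u (\<lambda>x y. f x * g y)"

lemma functional_tensor_sum:
  fixes f :: "'a::real_normed_vector \<Rightarrow> 'k::{real_normed_field,euclidean_space}"
    and g :: "'b::real_normed_vector \<Rightarrow> 'k"
  assumes "normed_space_over sE" "normed_space_over sF" "f \<in> dual sE" "g \<in> dual sF"
  shows "functional_tensor f g (tensor_sum sE sF ps) = (\<Sum>(x, y)\<leftarrow>ps. f x * g y)"
proof -
  interpret E: normed_space_over sE by fact
  interpret F: normed_space_over sF by fact
  interpret f: bounded_linear f using assms by (simp add: dual_def)
  interpret g: bounded_linear g using assms by (simp add: dual_def)
  have "vector_space ((*) :: 'k \<Rightarrow> 'k \<Rightarrow> 'k)" by unfold_locales (simp_all add: algebra_simps)
  then have "bilinear_form sE sF (\<lambda>x y. f x * g y)"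
    using assms E.vector_space_axioms F.vector_space_axioms
    by (auto simp: bilinear_form_def Vector_Spaces.linear_iff dual_def f.add g.add algebra_simps)
  then show ?thesis
    by (simp add: functional_tensor_def tensor_sum_def elem_tensor_def)
qed


definition Bess ::
  "('k::{real_normed_field,euclidean_space} \<Rightarrow> 'a::real_normed_vector \<Rightarrow> 'a) \<Rightarrow>
   ('k \<Rightarrow> 'b::real_normed_vector \<Rightarrow> 'b) \<Rightarrow>
   (nat \<Rightarrow> 'a) \<Rightarrow> (nat \<Rightarrow> 'a \<Rightarrow> 'k) \<Rightarrow> (nat \<Rightarrow> 'b) \<Rightarrow> (nat \<Rightarrow> 'b \<Rightarrow> 'k) \<Rightarrow> ('a \<times> 'b) list \<Rightarrow> ennreal"
  where "Bess sE sF a b x y ps =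
    (SUP (f, g) \<in> dual_ball sE \<times> dual_ball sF.
      \<Sum>(p, q)\<leftarrow>ps. \<Sum>m. \<Sum>n. ennreal (norm (b m p * y n q * f (a m) * g (x n))))"

definition bess_norm ::
  "('k::{real_normed_field,euclidean_space} \<Rightarrow> 'a::real_normed_vector \<Rightarrow> 'a) \<Rightarrow>
   ('k \<Rightarrow> 'b::real_normed_vector \<Rightarrow> 'b) \<Rightarrow>
   (nat \<Rightarrow> 'a) \<Rightarrow> (nat \<Rightarrow> 'a \<Rightarrow> 'k) \<Rightarrow> (nat \<Rightarrow> 'b) \<Rightarrow> (nat \<Rightarrow> 'b \<Rightarrow> 'k) \<Rightarrow> ('k, 'a, 'b) tensor \<Rightarrow> real"
  where "bess_norm sE sF a b x y u =
    enn2real (INF ps \<in> {ps. tensor_sum sE sF ps = u}. Bess sE sF a b x y ps)"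


(* A completion is determined only up to isometric isomorphism. It is represented by a Banach
   space 'c with a linear isometry j, with respect to the norm N, from the tensor product onto a
   dense subspace of 'c. *)

definition tensor_completion ::
  "('k::{real_normed_field,euclidean_space} \<Rightarrow> 'a::real_normed_vector \<Rightarrow> 'a) \<Rightarrow>
   ('k \<Rightarrow> 'b::real_normed_vector \<Rightarrow> 'b) \<Rightarrow> (('k, 'a, 'b) tensor \<Rightarrow> real) \<Rightarrow>
   ('k \<Rightarrow> 'c::banach \<Rightarrow> 'c) \<Rightarrow> (('k, 'a, 'b) tensor \<Rightarrow> 'c) \<Rightarrow> bool"
  where "tensor_completion sE sF N sG j \<longleftrightarrow>
    normed_space_over sG \<and>
    (\<forall>u \<in> tensor_product sE sF. \<forall>v \<in> tensor_product sE sF. j (\<lambda>B. u B + v B) = j u + j v) \<and>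
    (\<forall>c. \<forall>u \<in> tensor_product sE sF. j (\<lambda>B. c * u B) = sG c (j u)) \<and>
    (\<forall>u \<in> tensor_product sE sF. norm (j u) = N u) \<and>
    closure (j ` tensor_product sE sF) = UNIV"

(* The extension by continuity of a functional on the tensor product to the completion; it is
   unique, if it exists, because the range of j is dense. *)

definition completion_extension ::
  "('k, 'a, 'b) tensor set \<Rightarrow> (('k, 'a, 'b) tensor \<Rightarrow> 'c::topological_space) \<Rightarrow>
   (('k, 'a, 'b) tensor \<Rightarrow> 'k::topological_space) \<Rightarrow> 'c \<Rightarrow> 'k"
  where "completion_extension T j h =
    (THE \<phi>. continuous_on UNIV \<phi> \<and> (\<forall>u \<in> T. \<phi> (j u) = h u))"


(* The square ordering, with indices shifted to start at 0: position k lies in the shell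
   max m n = N with N the integer square root of k, at offset r = k - N^2. *)

definition square_ordering :: "nat \<Rightarrow> nat \<times> nat"
  where "square_ordering k =
    (let N = floor_sqrt k; r = k - N\<^sup>2 in if r \<le> N then (r, N) else (N, 2 * N - r))"

lemma square_ordering_up:
  assumes "i \<le> N" shows "square_ordering (N\<^sup>2 + i) = (i, N)"
proof -
  have "floor_sqrt (N\<^sup>2 + i) = N"
    using assms by (intro floor_sqrt_unique) (auto simp: power2_eq_square)
  then show ?thesis using assms by (simp add: square_ordering_def)
qed

lemma square_ordering_down:
  assumes "i < N" shows "square_ordering (N\<^sup>2 + 2 * N - i) = (N, i)"
proof -
  have "floor_sqrt (N\<^sup>2 + 2 * N - i) = N"
    using assms by (intro floor_sqrt_unique) (auto simp: power2_eq_square)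
  moreover have "N\<^sup>2 + 2 * N - i - N\<^sup>2 = 2 * N - i" by simp
  ultimately show ?thesis using assms by (simp add: square_ordering_def Let_def)
qed

end

theory Submission
  imports Defs
begin

text \<open>
  Write \<open>\<phi>\<^sub>m\<^sub>n\<close> for the functional \<open>b\<^sub>m \<otimes> y\<^sub>n\<close>. The theorem holds because the square-ordered products
  form a biorthogonal system with dense span whose finite coordinate projections are contractions
  for the Besselian norm; \<open>USB_criterion\<close> turns this into unconditionality.

  Contractivity (\<open>norm_projection_le\<close>): let \<open>A\<close> be a finite set of pairs of indices. The projection
  of \<open>u = \<Sum> p\<^sub>r \<otimes> q\<^sub>r\<close> is \<open>\<Sum> \<phi>\<^sub>m\<^sub>n(u) a\<^sub>m \<otimes> x\<^sub>n\<close>, summed over \<open>(m,n) \<in> A\<close>. By biorthogonality, \<open>Bess\<close> of this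
  representation is the supremum of \<open>\<Sum> \<bar>\<phi>\<^sub>m\<^sub>n(u) f(a\<^sub>m) g(x\<^sub>n)\<bar>\<close> over \<open>f\<close> and \<open>g\<close> in the unit balls of the
  duals, and \<open>\<bar>\<phi>\<^sub>m\<^sub>n(u)\<bar> \<le> \<Sum>\<^sub>r \<bar>b\<^sub>m(p\<^sub>r) y\<^sub>n(q\<^sub>r)\<bar>\<close>, so it is at most \<open>Bess\<close> of any representation of \<open>u\<close>.
  The same estimate for a single pair \<open>(m,n)\<close>, with \<open>f\<close> and \<open>g\<close> multiples of \<open>b\<^sub>m\<close> and \<open>y\<^sub>n\<close>, shows that
  \<open>\<phi>\<^sub>m\<^sub>n\<close> is continuous, so that it extends to the completion (\<open>coeff_bound\<close>).

  Density (\<open>closure_span_basis_tensors\<close>): put \<open>\<beta>(p) = sup\<^sub>f \<Sum>\<^sub>m \<bar>b\<^sub>m(p) f(a\<^sub>m)\<bar>\<close> and define \<open>\<gamma>\<close> likewise on the second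
  factor. The norm of \<open>p \<otimes> q\<close> is at most \<open>\<beta>(p) \<gamma>(q)\<close>, hence \<open>p \<otimes> q\<close> is the limit of the
  products of the partial sums of \<open>p\<close> and \<open>q\<close> once the remainders of \<open>p\<close> and \<open>q\<close> tend to 0 for \<open>\<beta>\<close> and \<open>\<gamma>\<close>.
  That is where the unconditionality of the given bases enters: all finite sums
  of sufficiently late terms of an unconditionally convergent series are uniformly small
  (\<open>unconditionally_convergent_small_tails\<close>), and sums of absolute values in a finite-dimensional
  scalar field are controlled by the moduli of subset sums (\<open>uniformly_small_tails\<close>).
\<close>

section \<open>Tails of unconditionally convergent series\<close>

text \<open>Otherwise there are successive blocks of indices, each containing a subset with a sum of norm
  greater than \<open>e\<close>. Permuting every block so that this subset comes first gives a
  rearrangement that violates the Cauchy criterion.\<close>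

lemma unconditionally_convergent_small_tails:
  fixes v :: "nat \<Rightarrow> 'a::banach"
  assumes v: "unconditionally_convergent v" and e: "e > 0"
  obtains N where "\<And>A. finite A \<Longrightarrow> A \<subseteq> {N..} \<Longrightarrow> norm (sum v A) \<le> e"
proof (rule ccontr)
  assume "\<not> thesis"
  with that have large: "\<exists>A. finite A \<and> A \<subseteq> {N..} \<and> e < norm (sum v A)" for N
    by (meson not_le)
  have "\<exists>M q r. N < M \<and> r \<le> M \<and> bij_betw q {N..<M} {N..<M} \<and> e < norm (\<Sum>i\<in>{N..<r}. v (q i))" for N
  proof -
    obtain A where A: "finite A" "A \<subseteq> {N..}" "e < norm (sum v A)" using large by blast
    then have "A \<noteq> {}" using e by auto
    define M where "M = Suc (Max A)"
    define r where "r = N + card A"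
    have AM: "A \<subseteq> {N..<M}"
      using A by (auto simp: M_def less_Suc_eq_le)
    then have "card A \<le> card {N..<M}" by (intro card_mono) auto
    moreover have "N < M" using AM \<open>A \<noteq> {}\<close> by force
    ultimately have r: "N \<le> r" "r \<le> M" by (auto simp: r_def)
    obtain q1 where q1: "bij_betw q1 {N..<r} A"
      using finite_same_card_bij[of "{N..<r}" A] A by (auto simp: r_def)
    have "card {r..<M} = card ({N..<M} - A)"
      using AM A by (simp add: card_Diff_subset r_def)
    then obtain q2 where q2: "bij_betw q2 {r..<M} ({N..<M} - A)"
      using finite_same_card_bij[of "{r..<M}" "{N..<M} - A"] by auto
    define q where "q = (\<lambda>i. if i \<in> {N..<r} then q1 i else q2 i)"
    have "bij_betw q ({N..<r} \<union> {r..<M}) (A \<union> ({N..<M} - A))"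
      unfolding q_def by (intro bij_betw_disjoint_Un q1 q2) auto
    moreover have "{N..<r} \<union> {r..<M} = {N..<M}" "A \<union> ({N..<M} - A) = {N..<M}"
      using r AM by auto
    moreover have "(\<Sum>i\<in>{N..<r}. v (q i)) = sum v A"
      using sum.reindex_bij_betw[OF q1, of v] by (simp add: q_def)
    ultimately show ?thesis using A \<open>N < M\<close> \<open>r \<le> M\<close> by metis
  qed
  then obtain M q r where M: "\<And>N. N < M N" and rM: "\<And>N. r N \<le> M N"
    and q: "\<And>N::nat. bij_betw (q N) {N..<M N} {N..<M N}"
    and large_block: "\<And>N. e < norm (\<Sum>i\<in>{N..<r N}. v (q N i))"
    by metis
  \<comment> \<open>The blocks are the intervals from \<open>s k\<close> to \<open>s (Suc k)\<close>, and \<open>\<kappa> n\<close> is the block of \<open>n\<close>.\<close>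
  define s where "s k = (M ^^ k) 0" for k
  have s_Suc: "s (Suc k) = M (s k)" for k by (simp add: s_def)
  have s_mono: "strict_mono s" by (simp add: strict_mono_Suc_iff s_Suc M)
  define \<kappa> where "\<kappa> n = (LEAST k. n < s (Suc k))" for n
  have \<kappa>: "\<kappa> n = k" if "n \<in> {s k..<s (Suc k)}" for n k
    unfolding \<kappa>_def
  proof (rule Least_equality)
    fix l assume "n < s (Suc l)"
    then have "s k < s (Suc l)" using that by simp
    then show "k \<le> l" using strict_mono_less[OF s_mono] by simp
  qed (use that in auto)
  have cover: "(\<Union>k. {s k..<s (Suc k)}) = UNIV"
  proof -
    have "n \<in> {s (\<kappa> n)..<s (Suc (\<kappa> n))}" for n
    proof -
      have "n \<le> s n" using s_mono by (rule strict_mono_imp_increasing)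
      then have "n < s (Suc n)" using M[of "s n"] by (simp add: s_Suc)
      then have 1: "n < s (Suc (\<kappa> n))" unfolding \<kappa>_def by (rule LeastI)
      have "s (\<kappa> n) \<le> n"
      proof (cases "\<kappa> n")
        case 0 then show ?thesis by (simp add: s_def)
      next
        case (Suc l)
        then have "\<not> n < s (Suc l)" unfolding \<kappa>_def by (metis lessI not_less_Least)
        then show ?thesis using Suc by simp
      qed
      with 1 show ?thesis by simp
    qed
    then show ?thesis by blast
  qed
  have disj: "disjoint_family (\<lambda>k. {s k..<s (Suc k)})"
    unfolding disjoint_family_on_def using \<kappa> by blast
  define p where "p n = q (s (\<kappa> n)) n" for n
  have p: "p n = q (s k) n" if "n \<in> {s k..<s (Suc k)}" for n k
    using \<kappa>[OF that] by (simp add: p_def)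
  have "bij_betw p {s k..<s (Suc k)} {s k..<s (Suc k)}" for k
    using q[of "s k"] bij_betw_cong[of "{s k..<s (Suc k)}" p "q (s k)"] p s_Suc by simp
  then have "bij_betw p (\<Union>k. {s k..<s (Suc k)}) (\<Union>k. {s k..<s (Suc k)})"
    using disj by (intro bij_betw_UNION_disjoint) auto
  then have "bij p" by (simp add: cover)
  then have "summable (\<lambda>m. v (p m))"
    using v by (simp add: unconditionally_convergent_def)
  then obtain K where K: "\<And>m n. m \<ge> K \<Longrightarrow> norm (\<Sum>i\<in>{m..<n}. v (p i)) < e"
    using e unfolding summable_Cauchy by blast
  have "K \<le> s K" using s_mono by (rule strict_mono_imp_increasing)
  then have "norm (\<Sum>i\<in>{s K..<r (s K)}. v (p i)) < e" by (rule K)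
  moreover have "(\<Sum>i\<in>{s K..<r (s K)}. v (p i)) = (\<Sum>i\<in>{s K..<r (s K)}. v (q (s K) i))"
    using rM[of "s K"] by (intro sum.cong refl) (auto simp: p s_Suc intro!: arg_cong[of _ _ v] p)
  ultimately show False using large_block[of "s K"] by simp
qed


section \<open>A criterion for unconditional bases\<close>

lemma bounded_linear_dual: "f \<in> dual smul \<Longrightarrow> bounded_linear f"
  by (simp add: dual_def)

lemma dual_smul: "f \<in> dual smul \<Longrightarrow> f (smul c x) = c * f x"
  by (simp add: dual_def)

lemma dual_ball_norm_le:
  assumes "f \<in> dual_ball smul" shows "norm (f x) \<le> norm x"
proof -
  have f: "bounded_linear f" "onorm f \<le> 1" using assms by (auto simp: dual_ball_def dual_def)
  have "norm (f x) \<le> onorm f * norm x" by (rule onorm[OF f(1)])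
  also have "\<dots> \<le> 1 * norm x" using f(2) by (rule mult_right_mono) simp
  finally show ?thesis by simp
qed

text \<open>The factor uses \<open>1 + onorm f\<close> rather than \<open>onorm f\<close> so that no case distinction for zero
  is needed.\<close>

lemma scaled_functional_in_dual_ball:
  assumes f: "f \<in> dual smul"
  shows "(\<lambda>x. inverse (1 + onorm f) *\<^sub>R f x) \<in> dual_ball smul"
proof -
  have bl: "bounded_linear f" using f by (rule bounded_linear_dual)
  have "0 \<le> onorm f" using bl by (rule onorm_pos_le)
  then have "\<bar>inverse (1 + onorm f)\<bar> * onorm f \<le> 1" by (simp add: field_simps)
  then have "onorm (\<lambda>x. inverse (1 + onorm f) *\<^sub>R f x) \<le> 1" by (simp only: onorm_scaleR[OF bl])
  then show ?thesis
    using bl f by (auto simp: dual_ball_def dual_def intro: bounded_linear_compose[OF bounded_linear_scaleR_right])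
qed

context normed_space_over
begin

lemma bounded_linear_smul: "bounded_linear (smul c)"
proof (rule bounded_linear_intro[where K = "norm c"])
  show "smul c (r *\<^sub>R x) = r *\<^sub>R smul c x" for r x
    unfolding smul_of_real[symmetric] by (simp add: mult.commute)
qed (simp_all add: scale_right_distrib norm_smul mult.commute)

lemma bounded_linear_smul_left: "bounded_linear (\<lambda>c. smul c x)"
proof (rule bounded_linear_intro[where K = "norm x"])
  show "smul (r *\<^sub>R c) x = r *\<^sub>R smul c x" for r c
    unfolding smul_of_real[symmetric] by (simp add: scaleR_conv_of_real)
qed (simp_all add: scale_left_distrib norm_smul)

text \<open>A biorthogonal system with dense span and uniformly bounded finite coordinate projections
  is an unconditional basis: expansions converge on the span, and the uniform bound carries
  the convergence over to the closure. Unordered summation makes every rearrangement converge.\<close>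

lemma USB_criterion:
  fixes e :: "nat \<Rightarrow> 'a" and \<phi> :: "nat \<Rightarrow> 'a \<Rightarrow> 'k"
  assumes dual: "\<And>k. \<phi> k \<in> dual smul"
    and biorth: "\<And>i k. \<phi> i (e k) = (if i = k then 1 else 0)"
    and bdd: "\<And>K z. finite K \<Longrightarrow> norm (\<Sum>k\<in>K. smul (\<phi> k z) (e k)) \<le> C * norm z"
    and dense: "closure (span (range e)) = UNIV"
  shows "USB smul e \<phi>"
proof -
  have lin: "bounded_linear (\<phi> k)" for k using dual by (rule bounded_linear_dual)
  note add = bounded_linear.linear[OF lin, THEN linear_add]
    and diff = bounded_linear.linear[OF lin, THEN linear_diff]
    and zero = bounded_linear.linear[OF lin, THEN linear_0]
  \<comment> \<open>\<open>W\<close> consists of the vectors that are the unordered sums of their own expansions.\<close>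
  define W where "W = {z. ((\<lambda>k. smul (\<phi> k z) (e k)) has_sum z) UNIV}"
  have "subspace W"
    unfolding subspace_def W_def
  proof (safe)
    show "((\<lambda>k. smul (\<phi> k 0) (e k)) has_sum 0) UNIV" by (simp add: zero)
  next
    fix z w assume "((\<lambda>k. smul (\<phi> k z) (e k)) has_sum z) UNIV" "((\<lambda>k. smul (\<phi> k w) (e k)) has_sum w) UNIV"
    from has_sum_add[OF this]
    show "((\<lambda>k. smul (\<phi> k (z + w)) (e k)) has_sum z + w) UNIV" by (simp add: add scale_left_distrib)
  next
    fix c z assume "((\<lambda>k. smul (\<phi> k z) (e k)) has_sum z) UNIV"
    from has_sum_bounded_linear[OF bounded_linear_smul[of c] this]
    show "((\<lambda>k. smul (\<phi> k (smul c z)) (e k)) has_sum smul c z) UNIV"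
      by (simp add: dual_smul[OF dual])
  qed
  moreover have "range e \<subseteq> W"
    unfolding W_def
  proof safe
    show "((\<lambda>k. smul (\<phi> k (e i)) (e k)) has_sum e i) UNIV" for i
      by (rule has_sum_finite_neutralI[where B = "{i}"]) (auto simp: biorth)
  qed
  ultimately have span: "span (range e) \<subseteq> W" by (rule span_minimal[rotated])
  have C: "0 \<le> C"
    using bdd[of "{0}" "e 0"] biorth[of 0 0] by (auto simp: zero mult_le_cancel_right1)
  have expand: "((\<lambda>k. smul (\<phi> k z) (e k)) has_sum z) UNIV" for z
    unfolding has_sum_def
  proof (rule tendstoI)
    fix \<epsilon> :: real assume "\<epsilon> > 0"
    then have "\<epsilon> / (C + 2) > 0" using C by simp
    moreover have "z \<in> closure (span (range e))" by (simp add: dense)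
    ultimately obtain w where w: "w \<in> span (range e)" "dist w z < \<epsilon> / (C + 2)"
      unfolding closure_approachable by blast
    then have "((\<lambda>k. smul (\<phi> k w) (e k)) has_sum w) UNIV" using span by (auto simp: W_def)
    then have "eventually (\<lambda>K. dist (\<Sum>k\<in>K. smul (\<phi> k w) (e k)) w < \<epsilon> / (C + 2)) (finite_subsets_at_top UNIV)"
      unfolding has_sum_def using \<open>\<epsilon> / (C + 2) > 0\<close> by (rule tendstoD)
    moreover have "eventually finite (finite_subsets_at_top (UNIV :: nat set))"
      by (rule eventually_finite_subsets_at_top_weakI)
    ultimately show "eventually (\<lambda>K. dist (\<Sum>k\<in>K. smul (\<phi> k z) (e k)) z < \<epsilon>) (finite_subsets_at_top UNIV)"
    proof eventually_elim
      fix K assume K: "dist (\<Sum>k\<in>K. smul (\<phi> k w) (e k)) w < \<epsilon> / (C + 2)" "finite K"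
      let ?P = "\<lambda>z. \<Sum>k\<in>K. smul (\<phi> k z) (e k)"
      have "?P (z - w) = ?P z - ?P w"
        by (simp add: diff scale_left_diff_distrib sum_subtractf)
      then have "?P z - z = ?P (z - w) + (?P w - w) + (w - z)" by simp
      then have "norm (?P z - z) = norm (?P (z - w) + (?P w - w) + (w - z))" by (rule arg_cong)
      also have "\<dots> \<le> norm (?P (z - w)) + norm (?P w - w) + norm (w - z)"
        by (rule norm_triangle_le[OF add_right_mono[OF norm_triangle_ineq]])
      also have "\<dots> < C * (\<epsilon> / (C + 2)) + \<epsilon> / (C + 2) + \<epsilon> / (C + 2)"
      proof -
        have "norm (?P (z - w)) \<le> C * norm (z - w)" using K(2) by (rule bdd)
        also have "\<dots> \<le> C * (\<epsilon> / (C + 2))"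
          using w(2) C by (intro mult_left_mono) (auto simp: dist_norm norm_minus_commute)
        finally show ?thesis using w(2) K(1) by (simp add: dist_norm)
      qed
      also have "\<dots> = (C + 2) * (\<epsilon> / (C + 2))" by (simp only: distrib_right mult_2 add.assoc)
      also have "\<dots> = \<epsilon>" using C by simp
      finally show "dist (?P z) z < \<epsilon>" by (simp add: dist_norm)
    qed
  qed
  have unique: "l = (\<lambda>k. \<phi> k z)" if "(\<lambda>k. smul (l k) (e k)) sums z" for l z
  proof
    fix i
    have "(\<lambda>k. \<phi> i (smul (l k) (e k))) sums \<phi> i z"
      using lin that by (rule bounded_linear.sums)
    moreover have "(\<lambda>k. \<phi> i (smul (l k) (e k))) = (\<lambda>k. if k = i then l k else 0)"
      by (intro ext) (simp add: dual_smul[OF dual] biorth)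
    ultimately show "l i = \<phi> i z"
      using sums_unique2[OF sums_single[of i l]] by simp
  qed
  have sums: "(\<lambda>k. smul (\<phi> k z) (e k)) sums z" for z
    using expand by (rule has_sum_imp_sums)
  have "unconditionally_convergent (\<lambda>k. smul (\<phi> k z) (e k))" for z
    unfolding unconditionally_convergent_def
  proof safe
    fix p :: "nat \<Rightarrow> nat" assume "bij p"
    then have "((\<lambda>k. smul (\<phi> (p k) z) (e (p k))) has_sum z) UNIV"
      using has_sum_reindex_bij_betw[of p UNIV UNIV "\<lambda>k. smul (\<phi> k z) (e k)" z] expand by simp
    then show "summable (\<lambda>k. smul (\<phi> (p k) z) (e (p k)))"
      using has_sum_imp_sums sums_summable by blast
  qed
  then have "unconditionally_convergent (\<lambda>k. smul (l k) (e k))"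
    if "(\<lambda>k. smul (l k) (e k)) sums z" for l z
    using unique[OF that] by simp
  moreover have "\<exists>!l. (\<lambda>k. smul (l k) (e k)) sums z" for z
    using sums unique by (rule ex1I)
  ultimately show ?thesis
    unfolding USB_def unconditional_schauder_basis_def schauder_basis_def
    using sums dual by blast
qed

lemma USB_biorthogonal:
  assumes "USB smul a b"
  shows "b i (a k) = (if i = k then 1 else 0)"
proof -
  have 1: "(\<lambda>m. smul (b m (a k)) (a m)) sums a k" using assms by (simp add: USB_def)
  have 2: "(\<lambda>m. smul (if m = k then 1 else 0) (a m)) sums a k"
    using sums_single[of k a] by (simp add: if_distrib[of "\<lambda>c. smul c _"] cong: if_cong)
  obtain l0 where l0: "\<And>l. (\<lambda>m. smul (l m) (a m)) sums a k \<Longrightarrow> l = l0"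
    using assms unfolding USB_def unconditional_schauder_basis_def schauder_basis_def by blast
  have "(\<lambda>m. b m (a k)) = (\<lambda>m. if m = k then 1 else 0)"
    using l0[OF 1] l0[OF 2] by (rule trans[OF _ sym])
  then show ?thesis by (rule fun_cong)
qed

lemma USB_partial_sum:
  assumes "USB smul a b"
  shows "b m (\<Sum>i<N. smul (b i p) (a i)) = (if m < N then b m p else 0)"
proof -
  have b: "b m \<in> dual smul" using assms by (simp add: USB_def)
  have "b m (\<Sum>i<N. smul (b i p) (a i)) = (\<Sum>i<N. b i p * (if m = i then 1 else 0))"
    using USB_biorthogonal[OF assms]
    by (simp add: linear_sum[OF bounded_linear.linear[OF bounded_linear_dual[OF b]]] dual_smul[OF b])
  then show ?thesis by (simp add: if_distrib cong: if_cong)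
qed


end

section \<open>The Besselian norm of a single factor\<close>

text \<open>The supremum, over the functionals \<open>f\<close> in the unit ball of the dual, of the sum of the
  absolute values of \<open>f\<close> on the terms of the expansion of \<open>p\<close>. For an unconditional basis the
  supremum is finite (\<open>ennreal_besselian_norm\<close>), so passing to a real number loses nothing.\<close>

definition besselian_norm ::
  "('k::{real_normed_field,euclidean_space} \<Rightarrow> 'a::real_normed_vector \<Rightarrow> 'a) \<Rightarrow>
    (nat \<Rightarrow> 'a) \<Rightarrow> (nat \<Rightarrow> 'a \<Rightarrow> 'k) \<Rightarrow> 'a \<Rightarrow> real"
  where "besselian_norm smul a b p =
    enn2real (SUP f\<in>dual_ball smul. \<Sum>m. ennreal (norm (b m p * f (a m))))"

text \<open>A normed space, complete by its type, with a fixed unconditional basis \<open>a\<close> and its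
  coefficient functionals \<open>b\<close>.\<close>

locale unconditional_basis = normed_space_over smul
  for smul :: "'k::{real_normed_field,euclidean_space} \<Rightarrow> 'a::banach \<Rightarrow> 'a" +
  fixes a :: "nat \<Rightarrow> 'a" and b :: "nat \<Rightarrow> 'a \<Rightarrow> 'k"
  assumes USB: "USB smul a b"
begin

lemma coeff_dual: "b m \<in> dual smul" using USB by (simp add: USB_def)

lemmas biorthogonal = USB_biorthogonal[OF USB]
lemmas coeff_partial_sum = USB_partial_sum[OF USB]
lemmas bounded_linear_coeff = bounded_linear_dual[OF coeff_dual]

lemma coeff_diff: "b m (p - q) = b m p - b m q"
  using bounded_linear_coeff by (rule linear_diff[OF bounded_linear.linear])

text \<open>The uniformity in \<open>f\<close> is the point: small subset sums in norm give small subset sums of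
  scalars for all \<open>f\<close> in the unit ball at once, and in a finite-dimensional scalar field
  these bound the sum of absolute values up to the factor \<open>2 * DIM('k)\<close>.\<close>

lemma uniformly_small_tails:
  assumes e: "e > 0"
  obtains N where "\<And>f A. f \<in> dual_ball smul \<Longrightarrow> finite A \<Longrightarrow> A \<subseteq> {N..} \<Longrightarrow>
    (\<Sum>m\<in>A. norm (b m p * f (a m))) \<le> e"
proof -
  have "unconditionally_convergent (\<lambda>m. smul (l m) (a m))"
    if "(\<lambda>m. smul (l m) (a m)) sums z" for l z
    using USB that by (simp add: USB_def unconditional_schauder_basis_def)
  moreover have "(\<lambda>m. smul (b m p) (a m)) sums p" using USB by (simp add: USB_def)
  ultimately have "unconditionally_convergent (\<lambda>m. smul (b m p) (a m))" .
  moreover have "e / (2 * DIM('k)) > 0" using e by simp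
  ultimately obtain N where N: "\<And>A. finite A \<Longrightarrow> A \<subseteq> {N..} \<Longrightarrow>
      norm (\<Sum>m\<in>A. smul (b m p) (a m)) \<le> e / (2 * DIM('k))"
    by (rule unconditionally_convergent_small_tails) blast
  have "(\<Sum>m\<in>A. norm (b m p * f (a m))) \<le> e"
    if f: "f \<in> dual_ball smul" and A: "finite A" "A \<subseteq> {N..}" for f A
  proof -
    have fd: "f \<in> dual smul" using f by (simp add: dual_ball_def)
    have "(\<Sum>m\<in>A. norm (b m p * f (a m))) \<le> 2 * real DIM('k) * (e / (2 * DIM('k)))"
    proof (rule sum_norm_allsubsets_bound[OF A(1)])
      fix Q assume "Q \<subseteq> A"
      then have Q: "finite Q" "Q \<subseteq> {N..}" using A by (auto intro: finite_subset)
      have "(\<Sum>m\<in>Q. b m p * f (a m)) = f (\<Sum>m\<in>Q. smul (b m p) (a m))"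
        by (simp add: linear_sum[OF bounded_linear.linear[OF bounded_linear_dual[OF fd]]]
            dual_smul[OF fd])
      also have "norm \<dots> \<le> norm (\<Sum>m\<in>Q. smul (b m p) (a m))"
        using f by (rule dual_ball_norm_le)
      also have "\<dots> \<le> e / (2 * DIM('k))" using Q by (rule N)
      finally show "norm (\<Sum>m\<in>Q. b m p * f (a m)) \<le> e / (2 * DIM('k))" .
    qed
    then show ?thesis by simp
  qed
  then show ?thesis by (rule that)
qed

lemma besselian_norm_nonneg: "0 \<le> besselian_norm smul a b p"
  by (simp add: besselian_norm_def)

lemma SUP_expansion_le:
  assumes "\<And>f n. f \<in> dual_ball smul \<Longrightarrow> (\<Sum>m<n. norm (b m p * f (a m))) \<le> c"
  shows "(SUP f\<in>dual_ball smul. \<Sum>m. ennreal (norm (b m p * f (a m)))) \<le> ennreal c"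
proof (rule SUP_least)
  fix f assume "f \<in> dual_ball smul"
  then show "(\<Sum>m. ennreal (norm (b m p * f (a m)))) \<le> ennreal c"
    using assms by (intro suminf_le_const) (auto intro: ennreal_leI simp del: norm_mult)
qed

lemma besselian_norm_le:
  assumes "\<And>f n. f \<in> dual_ball smul \<Longrightarrow> (\<Sum>m<n. norm (b m p * f (a m))) \<le> c" and "c \<ge> 0"
  shows "besselian_norm smul a b p \<le> c"
  unfolding besselian_norm_def
  by (rule enn2real_leI[OF assms(2) SUP_expansion_le[OF assms(1)]])

lemma ennreal_besselian_norm:
  "ennreal (besselian_norm smul a b p) =
    (SUP f\<in>dual_ball smul. \<Sum>m. ennreal (norm (b m p * f (a m))))"
proof -
  obtain N where N: "\<And>f A. f \<in> dual_ball smul \<Longrightarrow> finite A \<Longrightarrow> A \<subseteq> {N..} \<Longrightarrow>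
      (\<Sum>m\<in>A. norm (b m p * f (a m))) \<le> 1"
    by (rule uniformly_small_tails[OF zero_less_one]) blast
  have "(\<Sum>m<n. norm (b m p * f (a m))) \<le> (\<Sum>m<N. norm (b m p) * norm (a m)) + 1"
    if f: "f \<in> dual_ball smul" for f n
  proof -
    have "(\<Sum>m<n. norm (b m p * f (a m))) \<le> (\<Sum>m\<in>{..<N} \<union> {N..<n}. norm (b m p * f (a m)))"
      by (intro sum_mono2) auto
    also have "\<dots> = (\<Sum>m<N. norm (b m p * f (a m))) + (\<Sum>m\<in>{N..<n}. norm (b m p * f (a m)))"
      by (intro sum.union_disjoint) auto
    also have "\<dots> \<le> (\<Sum>m<N. norm (b m p) * norm (a m)) + 1"
    proof (rule add_mono)
      show "(\<Sum>m<N. norm (b m p * f (a m))) \<le> (\<Sum>m<N. norm (b m p) * norm (a m))"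
        unfolding norm_mult using f by (intro sum_mono mult_left_mono dual_ball_norm_le norm_ge_zero)
      show "(\<Sum>m\<in>{N..<n}. norm (b m p * f (a m))) \<le> 1"
        using f by (rule N) auto
    qed
    finally show ?thesis .
  qed
  from SUP_expansion_le[OF this]
  have "(SUP f\<in>dual_ball smul. \<Sum>m. ennreal (norm (b m p * f (a m)))) < top"
    using ennreal_less_top by (rule order.strict_trans1)
  then show ?thesis by (simp add: besselian_norm_def del: norm_mult)
qed

lemma expansion_le_besselian_norm:
  assumes "f \<in> dual_ball smul"
  shows "(\<Sum>m. ennreal (norm (b m p * f (a m)))) \<le> ennreal (besselian_norm smul a b p)"
  unfolding ennreal_besselian_norm using assms by (rule SUP_upper)

lemma finite_expansion_le_besselian_norm:
  assumes "f \<in> dual_ball smul" "finite A"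
  shows "(\<Sum>m\<in>A. norm (b m p * f (a m))) \<le> besselian_norm smul a b p"
proof -
  have "(\<Sum>m\<in>A. ennreal (norm (b m p * f (a m)))) \<le> (\<Sum>m. ennreal (norm (b m p * f (a m))))"
    using assms(2) by (intro sum_le_suminf) auto
  also have "\<dots> \<le> ennreal (besselian_norm smul a b p)"
    using assms(1) by (rule expansion_le_besselian_norm)
  finally show ?thesis
    by (simp add: besselian_norm_nonneg del: norm_mult)
qed

lemma besselian_norm_partial_sum_le:
  "besselian_norm smul a b (\<Sum>i<N. smul (b i p) (a i)) \<le> besselian_norm smul a b p"
proof (rule besselian_norm_le)
  fix f n assume f: "f \<in> dual_ball smul"
  have "(\<Sum>m<n. norm (b m (\<Sum>i<N. smul (b i p) (a i)) * f (a m))) \<le> (\<Sum>m<n. norm (b m p * f (a m)))"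
    by (intro sum_mono) (simp add: coeff_partial_sum)
  also have "\<dots> \<le> besselian_norm smul a b p"
    using f by (rule finite_expansion_le_besselian_norm) simp
  finally show "(\<Sum>m<n. norm (b m (\<Sum>i<N. smul (b i p) (a i)) * f (a m))) \<le> besselian_norm smul a b p" .
qed (rule besselian_norm_nonneg)

lemma besselian_norm_remainder_tendsto_0:
  "(\<lambda>N. besselian_norm smul a b (p - (\<Sum>i<N. smul (b i p) (a i)))) \<longlonglongrightarrow> 0"
proof (rule LIMSEQ_I)
  fix e :: real assume "e > 0"
  then obtain M where M: "\<And>f A. f \<in> dual_ball smul \<Longrightarrow> finite A \<Longrightarrow> A \<subseteq> {M..} \<Longrightarrow>
      (\<Sum>m\<in>A. norm (b m p * f (a m))) \<le> e / 2"
    by (rule uniformly_small_tails[OF half_gt_zero]) blast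
  have "besselian_norm smul a b (p - (\<Sum>i<N. smul (b i p) (a i))) \<le> e / 2" if "N \<ge> M" for N
  proof (rule besselian_norm_le)
    fix f n assume f: "f \<in> dual_ball smul"
    have "(\<Sum>m<n. norm (b m (p - (\<Sum>i<N. smul (b i p) (a i))) * f (a m)))
        = (\<Sum>m\<in>{M..<n}. norm (b m (p - (\<Sum>i<N. smul (b i p) (a i))) * f (a m)))"
      using that by (intro sum.mono_neutral_right) (auto simp: coeff_diff coeff_partial_sum)
    also have "\<dots> \<le> (\<Sum>m\<in>{M..<n}. norm (b m p * f (a m)))"
      by (intro sum_mono) (simp add: coeff_diff coeff_partial_sum)
    also have "\<dots> \<le> e / 2" using f by (rule M) auto
    finally show "(\<Sum>m<n. norm (b m (p - (\<Sum>i<N. smul (b i p) (a i))) * f (a m))) \<le> e / 2" .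
  qed (use \<open>e > 0\<close> in simp)
  then have "norm (besselian_norm smul a b (p - (\<Sum>i<N. smul (b i p) (a i))) - 0) < e" if "N \<ge> M" for N
    using that \<open>e > 0\<close> by (simp add: besselian_norm_nonneg le_less_trans[of _ "e / 2"])
  then show "\<exists>M. \<forall>N\<ge>M. norm (besselian_norm smul a b (p - (\<Sum>i<N. smul (b i p) (a i))) - 0) < e"
    by blast
qed

end

section \<open>The square ordering is a bijection\<close>

lemma square_ordering_cases:
  obtains i N where "i \<le> N" "k = N\<^sup>2 + i" "square_ordering k = (i, N)"
  | i N where "i < N" "k = N\<^sup>2 + 2 * N - i" "square_ordering k = (N, i)"
proof -
  let ?N = "floor_sqrt k"
  have lower: "?N\<^sup>2 \<le> k" by simp
  have upper: "k \<le> ?N\<^sup>2 + 2 * ?N"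
    using Suc_floor_sqrt_power2_gt[of k] by (simp add: power2_eq_square)
  show thesis
  proof (cases "k - ?N\<^sup>2 \<le> ?N")
    case True
    with lower show thesis
      using that(1)[of "k - ?N\<^sup>2" ?N] square_ordering_up[of "k - ?N\<^sup>2" ?N] by simp
  next
    case False
    let ?i = "?N\<^sup>2 + 2 * ?N - k"
    have "?i < ?N" "k = ?N\<^sup>2 + 2 * ?N - ?i" using False upper by auto
    then show thesis using that(2)[of ?i ?N] square_ordering_down[of ?i ?N] by metis
  qed
qed

lemma inj_square_ordering: "inj square_ordering"
proof (rule injI)
  fix k l assume "square_ordering k = square_ordering l"
  then show "k = l"
    by (cases k rule: square_ordering_cases; cases l rule: square_ordering_cases) auto
qed

lemma surj_square_ordering: "surj square_ordering"
  unfolding surj_def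
proof
  fix mn :: "nat \<times> nat"
  obtain m n where mn: "mn = (m, n)" by (cases mn)
  show "\<exists>k. mn = square_ordering k"
  proof (cases "m \<le> n")
    case True
    then have "mn = square_ordering (n\<^sup>2 + m)" by (simp add: square_ordering_up mn)
    then show ?thesis by (rule exI)
  next
    case False
    then have "mn = square_ordering (m\<^sup>2 + 2 * m - n)" by (simp add: square_ordering_down mn)
    then show ?thesis by (rule exI)
  qed
qed

section \<open>The Besselian norm on the tensor product and its completion\<close>

lemma sum_le_double_suminf:
  fixes h :: "nat \<Rightarrow> nat \<Rightarrow> ennreal"
  assumes "finite A"
  shows "(\<Sum>(m, n)\<in>A. h m n) \<le> (\<Sum>m. \<Sum>n. h m n)"
proof -
  have "(\<Sum>(m, n)\<in>A. h m n) \<le> (\<Sum>(m, n)\<in>fst ` A \<times> snd ` A. h m n)"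
    using assms by (intro sum_mono2) (auto simp: image_iff split: prod.splits, force+)
  also have "\<dots> = (\<Sum>m\<in>fst ` A. \<Sum>n\<in>snd ` A. h m n)" by (simp add: sum.cartesian_product)
  also have "\<dots> \<le> (\<Sum>m\<in>fst ` A. \<Sum>n. h m n)"
    using assms by (intro sum_mono sum_le_suminf) auto
  also have "\<dots> \<le> (\<Sum>m. \<Sum>n. h m n)"
    using assms by (intro sum_le_suminf) auto
  finally show ?thesis .
qed

text \<open>Two spaces with unconditional bases, and a realisation \<open>j\<close> of the completion of their
  algebraic tensor product with respect to the Besselian norm.\<close>

locale besselian_completion =
  E: unconditional_basis sE a b + F: unconditional_basis sF x y
  for sE :: "'k::{real_normed_field,euclidean_space} \<Rightarrow> 'a::banach \<Rightarrow> 'a" and a b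
    and sF :: "'k \<Rightarrow> 'b::banach \<Rightarrow> 'b" and x y +
  fixes sG :: "'k \<Rightarrow> 'c::banach \<Rightarrow> 'c" and j :: "('k, 'a, 'b) tensor \<Rightarrow> 'c"
  assumes completion: "tensor_completion sE sF (bess_norm sE sF a b x y) sG j"
begin

sublocale G: normed_space_over sG
  using completion unfolding tensor_completion_def by blast

abbreviation T :: "('k, 'a, 'b) tensor set" where "T \<equiv> tensor_product sE sF"

abbreviation J :: "'a \<Rightarrow> 'b \<Rightarrow> 'c" where "J p q \<equiv> j (elem_tensor sE sF p q)"

abbreviation coeff :: "nat \<Rightarrow> nat \<Rightarrow> ('k, 'a, 'b) tensor \<Rightarrow> 'k"
  where "coeff m n \<equiv> functional_tensor (b m) (y n)"

lemma j_add: "u \<in> T \<Longrightarrow> v \<in> T \<Longrightarrow> j (\<lambda>B. u B + v B) = j u + j v"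
  using completion unfolding tensor_completion_def by blast

lemma j_scale: "u \<in> T \<Longrightarrow> j (\<lambda>B. c * u B) = sG c (j u)"
  using completion unfolding tensor_completion_def by blast

lemma norm_j: "u \<in> T \<Longrightarrow> norm (j u) = bess_norm sE sF a b x y u"
  using completion unfolding tensor_completion_def by blast

lemma j_dense: "closure (j ` T) = UNIV"
  using completion unfolding tensor_completion_def by blast

text \<open>A closed property of the completion need only be checked on the image of the algebraic
  tensor product.\<close>

lemma completion_induct:
  assumes "closed {z. P z}" and "\<And>u. u \<in> T \<Longrightarrow> P (j u)"
  shows "P z"
proof -
  have "closure (j ` T) \<subseteq> {z. P z}" using assms by (intro closure_minimal) auto
  then show ?thesis by (auto simp: j_dense)
qed

lemma tensor_sum_in: "tensor_sum sE sF ps \<in> T"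
  by (simp add: tensor_product_def)

lemma T_cases:
  assumes "u \<in> T" obtains ps where "u = tensor_sum sE sF ps"
  using assms by (auto simp: tensor_product_def)

lemma T_add: assumes "u \<in> T" "v \<in> T" shows "(\<lambda>B. u B + v B) \<in> T"
proof -
  obtain ps qs where "u = tensor_sum sE sF ps" "v = tensor_sum sE sF qs"
    using assms by (auto elim!: T_cases)
  then show ?thesis
    using tensor_sum_in[of "ps @ qs"] by (simp only: tensor_sum_append)
qed

lemma T_scale: assumes "u \<in> T" shows "(\<lambda>B. c * u B) \<in> T"
proof -
  obtain ps where u: "u = tensor_sum sE sF ps" using assms by (rule T_cases)
  have "(\<lambda>B. c * u B) = tensor_sum sE sF (map (\<lambda>(p, q). (sE c p, q)) ps)"
    unfolding u by (induction ps)
      (auto simp: tensor_sum_def fun_eq_iff elem_tensor_scale_left distrib_left)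
  then show ?thesis by (simp add: tensor_sum_in)
qed

lemma J_add_left: "J (p + p') q = J p q + J p' q"
  by (simp add: elem_tensor_add_left j_add elem_tensor_in_tensor_product)

lemma J_add_right: "J p (q + q') = J p q + J p q'"
  by (simp add: elem_tensor_add_right j_add elem_tensor_in_tensor_product)

lemma J_scale_left: "J (sE c p) q = sG c (J p q)"
  by (simp add: elem_tensor_scale_left j_scale elem_tensor_in_tensor_product)

lemma J_scale_right: "J p (sF c q) = sG c (J p q)"
  by (simp add: elem_tensor_scale_right j_scale elem_tensor_in_tensor_product)

lemma j_tensor_sum: "j (tensor_sum sE sF ps) = (\<Sum>(p, q)\<leftarrow>ps. J p q)"
proof (induction ps)
  case Nil
  have "j (\<lambda>B. 0) = 0"
    using j_scale[OF tensor_sum_in[of "[]"], of 0] by simp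
  then show ?case by simp
next
  case (Cons pq ps)
  obtain p q where pq: "pq = (p, q)" by (cases pq)
  have "tensor_sum sE sF (pq # ps) = (\<lambda>B. elem_tensor sE sF p q B + tensor_sum sE sF ps B)"
    by (simp add: tensor_sum_def pq)
  then show ?case
    by (simp add: pq j_add elem_tensor_in_tensor_product tensor_sum_in Cons.IH)
qed

lemma double_series_eq_product:
  "(\<Sum>m. \<Sum>n. ennreal (norm (b m p * y n q * f (a m) * g (x n)))) =
    (\<Sum>m. ennreal (norm (b m p * f (a m)))) * (\<Sum>n. ennreal (norm (y n q * g (x n))))"
proof -
  have "norm (b m p * y n q * f (a m) * g (x n)) = norm (b m p * f (a m)) * norm (y n q * g (x n))"
    for m n by (simp add: norm_mult)
  then show ?thesis by (simp add: ennreal_mult del: norm_mult)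
qed

text \<open>This bound shows that \<open>Bess\<close> is finite, so the norm of the completion is the actual infimum
  (\<open>ennreal_norm_j\<close>).\<close>

lemma Bess_le_sum:
  "Bess sE sF a b x y ps \<le>
    (\<Sum>(p, q)\<leftarrow>ps. ennreal (besselian_norm sE a b p * besselian_norm sF x y q))"
  unfolding Bess_def
proof (rule SUP_least, clarify)
  fix f g assume "f \<in> dual_ball sE" "g \<in> dual_ball sF"
  then show "(\<Sum>(p, q)\<leftarrow>ps. \<Sum>m. \<Sum>n. ennreal (norm (b m p * y n q * f (a m) * g (x n))))
      \<le> (\<Sum>(p, q)\<leftarrow>ps. ennreal (besselian_norm sE a b p * besselian_norm sF x y q))"
    unfolding double_series_eq_product
    by (intro sum_list_mono) (auto simp: ennreal_mult E.besselian_norm_nonneg F.besselian_norm_nonneg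
        intro!: mult_mono E.expansion_le_besselian_norm F.expansion_le_besselian_norm simp del: norm_mult)
qed

lemma Bess_finite: "Bess sE sF a b x y ps < top"
proof -
  have "(\<Sum>(p, q)\<leftarrow>ps. ennreal (besselian_norm sE a b p * besselian_norm sF x y q)) < top"
    by (induction ps) auto
  with Bess_le_sum show ?thesis by (rule order.strict_trans1)
qed

lemma ennreal_norm_j:
  "u \<in> T \<Longrightarrow> ennreal (norm (j u)) = (INF ps\<in>{ps. tensor_sum sE sF ps = u}. Bess sE sF a b x y ps)"
proof -
  assume u: "u \<in> T"
  then obtain ps where "u = tensor_sum sE sF ps" by (rule T_cases)
  then have "(INF ps\<in>{ps. tensor_sum sE sF ps = u}. Bess sE sF a b x y ps) \<le> Bess sE sF a b x y ps"
    by (intro INF_lower) simp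
  then have "(INF ps\<in>{ps. tensor_sum sE sF ps = u}. Bess sE sF a b x y ps) < top"
    using Bess_finite by (rule order.strict_trans1)
  then show ?thesis by (simp add: norm_j[OF u] bess_norm_def)
qed

lemma norm_j_tensor_sum_le: "ennreal (norm (j (tensor_sum sE sF ps))) \<le> Bess sE sF a b x y ps"
  unfolding ennreal_norm_j[OF tensor_sum_in] by (rule INF_lower) simp

lemma norm_J_le: "norm (J p q) \<le> besselian_norm sE a b p * besselian_norm sF x y q"
proof -
  have "ennreal (norm (J p q)) \<le> ennreal (besselian_norm sE a b p * besselian_norm sF x y q)"
    using order_trans[OF norm_j_tensor_sum_le[of "[(p, q)]"] Bess_le_sum[of "[(p, q)]"]]
    by (simp add: j_tensor_sum)
  then show ?thesis by (simp add: E.besselian_norm_nonneg F.besselian_norm_nonneg)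
qed

lemma coeff_tensor_sum: "coeff m n (tensor_sum sE sF ps) = (\<Sum>(p, q)\<leftarrow>ps. b m p * y n q)"
  by (intro functional_tensor_sum E.normed_space_over_axioms F.normed_space_over_axioms
      E.coeff_dual F.coeff_dual)

lemma coeff_elem: "coeff m n (elem_tensor sE sF p q) = b m p * y n q"
  using coeff_tensor_sum[of m n "[(p, q)]"] by (simp add: tensor_sum_def)

lemma coeff_basis:
  "coeff m n (elem_tensor sE sF (a k) (x l)) = (if (m, n) = (k, l) then 1 else 0)"
  by (simp add: coeff_elem E.biorthogonal F.biorthogonal)

text \<open>The key estimate: the left-hand side depends on \<open>u\<close> only, while the right-hand side refers to an
  arbitrary representation of \<open>u\<close>.\<close>

lemma coeff_sum_le_Bess:
  assumes "finite A" "f \<in> dual_ball sE" "g \<in> dual_ball sF" and u: "tensor_sum sE sF ps = u"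
  shows "(\<Sum>(m, n)\<in>A. ennreal (norm (coeff m n u * f (a m) * g (x n)))) \<le> Bess sE sF a b x y ps"
proof -
  have "(\<Sum>(m, n)\<in>A. ennreal (norm (coeff m n u * f (a m) * g (x n)))) \<le>
      (\<Sum>(p, q)\<leftarrow>ps. \<Sum>m. \<Sum>n. ennreal (norm (b m p * y n q * f (a m) * g (x n))))"
    unfolding u[symmetric] coeff_tensor_sum
  proof (induction ps)
    case Nil
    show ?case by (simp add: case_prod_beta)
  next
    case (Cons pq ps)
    obtain p q where pq: "pq = (p, q)" by (cases pq)
    let ?c = "\<lambda>m n. (\<Sum>(p, q)\<leftarrow>ps. b m p * y n q)"
    have "ennreal (norm ((\<Sum>(p, q)\<leftarrow>pq # ps. b m p * y n q) * f (a m) * g (x n)))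
        \<le> ennreal (norm (b m p * y n q * f (a m) * g (x n))) + ennreal (norm (?c m n * f (a m) * g (x n)))"
      for m n
      using norm_triangle_ineq[of "b m p * y n q * f (a m) * g (x n)" "?c m n * f (a m) * g (x n)"]
      by (simp add: pq distrib_right ennreal_leI flip: ennreal_plus del: norm_mult)
    then have "(\<Sum>(m, n)\<in>A. ennreal (norm ((\<Sum>(p, q)\<leftarrow>pq # ps. b m p * y n q) * f (a m) * g (x n))))
        \<le> (\<Sum>(m, n)\<in>A. ennreal (norm (b m p * y n q * f (a m) * g (x n))) + ennreal (norm (?c m n * f (a m) * g (x n))))"
      by (intro sum_mono) (simp only: case_prod_beta)
    also have "\<dots> = (\<Sum>(m, n)\<in>A. ennreal (norm (b m p * y n q * f (a m) * g (x n))))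
        + (\<Sum>(m, n)\<in>A. ennreal (norm (?c m n * f (a m) * g (x n))))"
      by (simp only: case_prod_unfold sum.distrib)
    also have "\<dots> \<le> (\<Sum>m. \<Sum>n. ennreal (norm (b m p * y n q * f (a m) * g (x n))))
        + (\<Sum>(p, q)\<leftarrow>ps. \<Sum>m. \<Sum>n. ennreal (norm (b m p * y n q * f (a m) * g (x n))))"
      by (intro add_mono sum_le_double_suminf assms Cons.IH)
    finally show ?case by (simp add: pq del: norm_mult)
  qed
  also have "\<dots> \<le> Bess sE sF a b x y ps"
    unfolding Bess_def using assms by (intro SUP_upper2[of "(f, g)"]) auto
  finally show ?thesis .
qed


text \<open>This follows from \<open>coeff_sum_le_Bess\<close> with multiples of \<open>b m\<close> and \<open>y n\<close> as test functionals,
  as \<open>b m (a m) = 1\<close> and \<open>y n (x n) = 1\<close>.\<close>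

lemma coeff_bound:
  assumes "u \<in> T"
  shows "norm (coeff m n u) \<le> (1 + onorm (b m)) * (1 + onorm (y n)) * norm (j u)"
proof -
  let ?f = "\<lambda>p. inverse (1 + onorm (b m)) *\<^sub>R b m p"
  let ?g = "\<lambda>q. inverse (1 + onorm (y n)) *\<^sub>R y n q"
  have pos: "0 \<le> onorm (b m)" "0 \<le> onorm (y n)"
    using E.bounded_linear_coeff F.bounded_linear_coeff by (auto intro: onorm_pos_le)
  have "ennreal (norm (coeff m n u * ?f (a m) * ?g (x n))) \<le> ennreal (norm (j u))"
    unfolding ennreal_norm_j[OF assms]
  proof (rule INF_greatest)
    fix ps assume "ps \<in> {ps. tensor_sum sE sF ps = u}"
    then show "ennreal (norm (coeff m n u * ?f (a m) * ?g (x n))) \<le> Bess sE sF a b x y ps"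
      using coeff_sum_le_Bess[of "{(m, n)}" ?f ?g ps u]
        scaled_functional_in_dual_ball[OF E.coeff_dual, of m]
        scaled_functional_in_dual_ball[OF F.coeff_dual, of n]
      by (simp del: norm_mult)
  qed
  moreover have "norm (coeff m n u * ?f (a m) * ?g (x n))
      = norm (coeff m n u) / ((1 + onorm (b m)) * (1 + onorm (y n)))"
    using pos by (simp add: E.biorthogonal F.biorthogonal norm_mult divide_inverse)
  ultimately show ?thesis
    using pos by (simp add: pos_divide_le_eq add_nonneg_pos mult.commute)
qed

text \<open>The finite coordinate projections are contractions on the algebraic tensor product.\<close>

lemma norm_projection_le:
  assumes u: "u \<in> T" and A: "finite A"
  shows "norm (\<Sum>(m, n)\<in>A. sG (coeff m n u) (J (a m) (x n))) \<le> norm (j u)"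
proof -
  obtain zs where zs: "set zs = A" "distinct zs" using finite_distinct_list[OF A] by blast
  \<comment> \<open>The obvious representation of the projection; by biorthogonality each of its elementary
    tensors contributes one term to the double series in \<open>Bess\<close>.\<close>
  define ps where "ps = map (\<lambda>(m, n). (sE (coeff m n u) (a m), x n)) zs"
  have eq: "(\<Sum>(m, n)\<in>A. sG (coeff m n u) (J (a m) (x n))) = j (tensor_sum sE sF ps)"
    unfolding zs(1)[symmetric] j_tensor_sum ps_def
    by (simp add: sum_list_distinct_conv_sum_set[OF zs(2)] J_scale_left case_prod_unfold comp_def)
  have E_single: "(\<Sum>i. ennreal (norm (b i (sE c (a m)) * f (a i)))) = ennreal (norm (c * f (a m)))"
    for c m and f :: "'a \<Rightarrow> 'k"
    by (subst suminf_finite[of "{m}"]) (auto simp: dual_smul[OF E.coeff_dual] E.biorthogonal)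
  have F_single: "(\<Sum>i. ennreal (norm (y i (x n) * g (x i)))) = ennreal (norm (g (x n)))"
    for n and g :: "'b \<Rightarrow> 'k"
    by (subst suminf_finite[of "{n}"]) (auto simp: F.biorthogonal)
  have single: "(\<Sum>i. ennreal (norm (b i (sE c (a m)) * f (a i)))) *
      (\<Sum>i. ennreal (norm (y i (x n) * g (x i)))) = ennreal (norm (c * f (a m) * g (x n)))"
    for c m n and f :: "'a \<Rightarrow> 'k" and g :: "'b \<Rightarrow> 'k"
    unfolding E_single F_single by (simp add: norm_mult ennreal_mult)
  have "Bess sE sF a b x y ps \<le> Bess sE sF a b x y qs" if qs: "tensor_sum sE sF qs = u" for qs
    unfolding Bess_def[of _ _ _ _ _ _ ps]
  proof (rule SUP_least, clarify)
    fix f g assume fg: "f \<in> dual_ball sE" "g \<in> dual_ball sF"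
    have "(\<Sum>(p, q)\<leftarrow>ps. \<Sum>m. \<Sum>n. ennreal (norm (b m p * y n q * f (a m) * g (x n))))
        = (\<Sum>(m, n)\<in>A. ennreal (norm (coeff m n u * f (a m) * g (x n))))"
      unfolding double_series_eq_product ps_def zs(1)[symmetric]
      by (simp add: sum_list_distinct_conv_sum_set[OF zs(2)] case_prod_unfold comp_def
          single del: norm_mult sum_ennreal)
    also have "\<dots> \<le> Bess sE sF a b x y qs"
      using A fg qs by (rule coeff_sum_le_Bess)
    finally show "(\<Sum>(p, q)\<leftarrow>ps. \<Sum>m. \<Sum>n. ennreal (norm (b m p * y n q * f (a m) * g (x n))))
        \<le> Bess sE sF a b x y qs" .
  qed
  then have "ennreal (norm (j (tensor_sum sE sF ps))) \<le> ennreal (norm (j u))"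
    unfolding ennreal_norm_j[OF u]
    by (intro INF_greatest order_trans[OF norm_j_tensor_sum_le]) simp
  then show ?thesis by (simp add: eq)
qed

text \<open>A linear functional on the tensor product that is bounded for the norm of the completion has
  an extension by continuity, which is again a linear functional.\<close>

lemma completion_extension_dual:
  assumes add: "\<And>u v. u \<in> T \<Longrightarrow> v \<in> T \<Longrightarrow> h (\<lambda>B. u B + v B) = h u + h v"
    and scale: "\<And>c u. u \<in> T \<Longrightarrow> h (\<lambda>B. c * u B) = c * h u"
    and bound: "\<And>u. u \<in> T \<Longrightarrow> norm (h u) \<le> K * norm (j u)" and K: "K \<ge> 0"
  shows "completion_extension T j h \<in> dual sG"
    and "u \<in> T \<Longrightarrow> completion_extension T j h (j u) = h u"
proof -
  have lip: "norm (h u - h v) \<le> K * norm (j u - j v)" if u: "u \<in> T" and v: "v \<in> T" for u v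
  proof -
    let ?w = "\<lambda>B. u B + (- 1) * v B"
    have v': "(\<lambda>B. (- 1) * v B) \<in> T" using v by (rule T_scale)
    have "norm (h ?w) \<le> K * norm (j ?w)" using T_add[OF u v'] by (rule bound)
    then show ?thesis
      unfolding add[OF u v'] j_add[OF u v'] scale[OF v] j_scale[OF v] by simp
  qed
  \<comment> \<open>By the Lipschitz estimate, \<open>h u\<close> depends on \<open>j u\<close> only, so the choice of \<open>u\<close> is immaterial and
    no injectivity of \<open>j\<close> is required.\<close>
  define h' where "h' z = h (SOME u. u \<in> T \<and> j u = z)" for z
  have h': "h' (j u) = h u" if u: "u \<in> T" for u
  proof -
    define v where "v = (SOME v. v \<in> T \<and> j v = j u)"
    have v: "v \<in> T \<and> j v = j u"
      unfolding v_def using u by (rule someI[where P = "\<lambda>v. v \<in> T \<and> j v = j u", OF conjI[OF _ refl]])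
    have "h' (j u) = h v" by (simp add: h'_def v_def)
    then show ?thesis using lip[of v u] u v by simp
  qed
  have "K-lipschitz_on (j ` T) h'"
    using lip K by (intro lipschitz_onI) (auto simp: h' dist_norm)
  then have "uniformly_continuous_on (j ` T) h'" by (rule lipschitz_on_uniformly_continuous)
  then obtain \<phi> where \<phi>: "uniformly_continuous_on (closure (j ` T)) \<phi>"
      "\<And>z. z \<in> j ` T \<Longrightarrow> h' z = \<phi> z"
    using uniformly_continuous_on_extension_on_closure by metis
  have cont: "continuous_on UNIV \<phi>"
    using \<phi>(1) by (simp add: j_dense uniformly_continuous_imp_continuous)
  have \<phi>_j: "\<phi> (j u) = h u" if "u \<in> T" for u using \<phi>(2)[of "j u"] h' that by simp
  have ext: "completion_extension T j h = \<phi>"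
    unfolding completion_extension_def
  proof (rule the_equality)
    fix \<psi> assume \<psi>: "continuous_on UNIV \<psi> \<and> (\<forall>u\<in>T. \<psi> (j u) = h u)"
    show "\<psi> = \<phi>"
    proof
      show "\<psi> z = \<phi> z" for z
        by (rule completion_induct[where P = "\<lambda>z. \<psi> z = \<phi> z"])
          (use \<psi> cont \<phi>_j in \<open>auto intro: closed_Collect_eq\<close>)
    qed
  qed (use cont \<phi>_j in auto)
  note cont_comp = continuous_on_compose2[OF cont _ subset_UNIV]
  have \<phi>_scale: "\<phi> (sG c z) = c * \<phi> z" for c z
  proof (rule completion_induct[where P = "\<lambda>z. \<phi> (sG c z) = c * \<phi> z"])
    show "closed {z. \<phi> (sG c z) = c * \<phi> z}"
      by (intro closed_Collect_eq cont_comp continuous_intros cont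
          linear_continuous_on G.bounded_linear_smul)
    show "\<phi> (sG c (j u)) = c * \<phi> (j u)" if "u \<in> T" for u
      using that by (simp add: \<phi>_j scale T_scale flip: j_scale)
  qed
  have \<phi>_add: "\<phi> (z + w) = \<phi> z + \<phi> w" for z w
  proof (rule completion_induct[where P = "\<lambda>z. \<phi> (z + w) = \<phi> z + \<phi> w"])
    show "closed {z. \<phi> (z + w) = \<phi> z + \<phi> w}"
      by (intro closed_Collect_eq cont_comp continuous_intros cont)
    show "\<phi> (j u + w) = \<phi> (j u) + \<phi> w" if u: "u \<in> T" for u
    proof (rule completion_induct[where P = "\<lambda>w. \<phi> (j u + w) = \<phi> (j u) + \<phi> w"])
      show "closed {w. \<phi> (j u + w) = \<phi> (j u) + \<phi> w}"
        by (intro closed_Collect_eq cont_comp continuous_intros cont)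
      show "\<phi> (j u + j v) = \<phi> (j u) + \<phi> (j v)" if v: "v \<in> T" for v
        using u v by (simp add: \<phi>_j add T_add flip: j_add)
    qed
  qed
  have \<phi>_bound: "norm (\<phi> z) \<le> norm z * K" for z
  proof (rule completion_induct[where P = "\<lambda>z. norm (\<phi> z) \<le> norm z * K"])
    show "closed {z. norm (\<phi> z) \<le> norm z * K}"
      by (intro closed_Collect_le continuous_intros cont)
    show "norm (\<phi> (j u)) \<le> norm (j u) * K" if "u \<in> T" for u
      using bound[OF that] by (simp add: \<phi>_j[OF that] mult.commute)
  qed
  have "\<phi> (r *\<^sub>R z) = r *\<^sub>R \<phi> z" for r z
    using \<phi>_scale[of "of_real r" z] by (simp add: G.smul_of_real scaleR_conv_of_real)
  then have "bounded_linear \<phi>"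
    using \<phi>_add \<phi>_bound by (intro bounded_linear_intro)
  then show "completion_extension T j h \<in> dual sG"
    using \<phi>_scale by (simp add: dual_def ext)
  show "u \<in> T \<Longrightarrow> completion_extension T j h (j u) = h u"
    by (simp add: ext \<phi>_j)
qed

abbreviation ext_coeff :: "nat \<Rightarrow> nat \<Rightarrow> 'c \<Rightarrow> 'k"
  where "ext_coeff m n \<equiv> completion_extension T j (coeff m n)"

lemma
  shows ext_coeff_dual: "ext_coeff m n \<in> dual sG"
    and ext_coeff_j: "u \<in> T \<Longrightarrow> ext_coeff m n (j u) = coeff m n u"
proof -
  have "(1 + onorm (b m)) * (1 + onorm (y n)) \<ge> 0"
    using E.bounded_linear_coeff F.bounded_linear_coeff by (simp add: onorm_pos_le)
  note ext = completion_extension_dual[where h = "coeff m n", OF _ _ coeff_bound this]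
  show "ext_coeff m n \<in> dual sG"
    by (rule ext) (simp_all add: functional_tensor_def)
  show "u \<in> T \<Longrightarrow> ext_coeff m n (j u) = coeff m n u"
    by (rule ext) (simp_all add: functional_tensor_def)
qed

lemma norm_ext_projection_le:
  assumes A: "finite A"
  shows "norm (\<Sum>(m, n)\<in>A. sG (ext_coeff m n z) (J (a m) (x n))) \<le> norm z"
proof (rule completion_induct[where
    P = "\<lambda>z. norm (\<Sum>(m, n)\<in>A. sG (ext_coeff m n z) (J (a m) (x n))) \<le> norm z"])
  have "continuous_on UNIV (\<lambda>z. sG (ext_coeff m n z) (J (a m) (x n)))" for m n
    by (intro linear_continuous_on
        bounded_linear_compose[OF G.bounded_linear_smul_left bounded_linear_dual[OF ext_coeff_dual]])
  then show "closed {z. norm (\<Sum>(m, n)\<in>A. sG (ext_coeff m n z) (J (a m) (x n))) \<le> norm z}"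
    unfolding case_prod_unfold by (intro closed_Collect_le continuous_intros)
  show "norm (\<Sum>(m, n)\<in>A. sG (ext_coeff m n (j u)) (J (a m) (x n))) \<le> norm (j u)"
    if u: "u \<in> T" for u
    using norm_projection_le[OF u A] by (simp add: ext_coeff_j[OF u])
qed

lemma J_partial_sums_tendsto:
  "(\<lambda>N. J (\<Sum>m<N. sE (b m p) (a m)) (\<Sum>n<N. sF (y n q) (x n))) \<longlonglongrightarrow> J p q"
proof -
  let ?p = "\<lambda>N. \<Sum>m<N. sE (b m p) (a m)" and ?q = "\<lambda>N. \<Sum>n<N. sF (y n q) (x n)"
  let ?\<beta> = "besselian_norm sE a b" and ?\<gamma> = "besselian_norm sF x y"
  have bound: "norm (J p q - J (?p N) (?q N)) \<le> ?\<beta> (p - ?p N) * ?\<gamma> q + ?\<beta> p * ?\<gamma> (q - ?q N)" for N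
  proof -
    have "J p q - J (?p N) (?q N) = J (p - ?p N) q + J (?p N) (q - ?q N)"
      using J_add_left[of "p - ?p N" "?p N" q] J_add_right[of "?p N" "q - ?q N" "?q N"] by simp
    also have "norm \<dots> \<le> norm (J (p - ?p N) q) + norm (J (?p N) (q - ?q N))"
      by (rule norm_triangle_ineq)
    also have "\<dots> \<le> ?\<beta> (p - ?p N) * ?\<gamma> q + ?\<beta> (?p N) * ?\<gamma> (q - ?q N)"
      by (intro add_mono norm_J_le)
    also have "\<dots> \<le> ?\<beta> (p - ?p N) * ?\<gamma> q + ?\<beta> p * ?\<gamma> (q - ?q N)"
      by (intro add_left_mono mult_right_mono E.besselian_norm_partial_sum_le F.besselian_norm_nonneg)
    finally show ?thesis .
  qed
  have "(\<lambda>N. ?\<beta> (p - ?p N) * ?\<gamma> q + ?\<beta> p * ?\<gamma> (q - ?q N)) \<longlonglongrightarrow> 0 * ?\<gamma> q + ?\<beta> p * 0"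
    by (intro tendsto_intros E.besselian_norm_remainder_tendsto_0 F.besselian_norm_remainder_tendsto_0)
  then have "(\<lambda>N. ?\<beta> (p - ?p N) * ?\<gamma> q + ?\<beta> p * ?\<gamma> (q - ?q N)) \<longlonglongrightarrow> 0"
    by (simp only: mult_zero_left mult_zero_right add_0)
  then have "(\<lambda>N. J p q - J (?p N) (?q N)) \<longlonglongrightarrow> 0"
    by (rule Lim_null_comparison[OF always_eventually[OF allI[OF bound]]])
  from tendsto_diff[OF tendsto_const[of "J p q"] this] show ?thesis
    by (simp only: diff_diff_eq2 add_diff_cancel_left' diff_zero)
qed

lemma J_sum: "J (\<Sum>m<M. sE (c m) (a m)) (\<Sum>n<N. sF (d n) (x n)) =
    (\<Sum>m<M. \<Sum>n<N. sG (c m) (sG (d n) (J (a m) (x n))))"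
proof -
  have lin_right: "Vector_Spaces.linear sF sG (J p)" for p
    using J_add_right J_scale_right F.vector_space_axioms G.vector_space_axioms
    by (simp add: Vector_Spaces.linear_iff)
  have right: "J p (\<Sum>n<N. sF (d n) (x n)) = (\<Sum>n<N. sG (d n) (J p (x n)))" for p
    by (simp only: module_hom.sum[OF module_hom_linearI[OF lin_right]] J_scale_right)
  have lin_left: "Vector_Spaces.linear sE sG (\<lambda>p. J p q)" for q
    using J_add_left J_scale_left E.vector_space_axioms G.vector_space_axioms
    by (simp add: Vector_Spaces.linear_iff)
  have left: "J (\<Sum>m<M. sE (c m) (a m)) q = (\<Sum>m<M. sG (c m) (J (a m) q))" for q
    by (simp only: module_hom.sum[OF module_hom_linearI[OF lin_left]] J_scale_left)
  show ?thesis
    unfolding left unfolding right G.scale_sum_right by (rule refl)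
qed

text \<open>Every elementary tensor, hence every element of the algebraic tensor product, is a limit of
  finite combinations of the products of the basis vectors.\<close>

lemma closure_span_basis_tensors:
  "closure (G.span (range (\<lambda>(m, n). J (a m) (x n)))) = UNIV"
proof -
  let ?V = "G.span (range (\<lambda>(m, n). J (a m) (x n)))"
  have add: "z + w \<in> closure ?V" if zw: "z \<in> closure ?V" "w \<in> closure ?V" for z w
  proof -
    obtain f g where "\<And>N. f N \<in> ?V" "f \<longlonglongrightarrow> z" "\<And>N. g N \<in> ?V" "g \<longlonglongrightarrow> w"
      using zw unfolding closure_sequential by blast
    then have "\<And>N. f N + g N \<in> ?V" "(\<lambda>N. f N + g N) \<longlonglongrightarrow> z + w"
      by (auto intro: G.span_add tendsto_add)
    then show ?thesis
      unfolding closure_sequential by (intro exI[of _ "\<lambda>N. f N + g N"] conjI allI)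
  qed
  have zero: "0 \<in> closure ?V" using G.span_zero closure_subset by blast
  have "J p q \<in> closure ?V" for p q
  proof (rule Lim_in_closed_set[OF closed_closure _ _ J_partial_sums_tendsto])
    have "J (\<Sum>m<N. sE (b m p) (a m)) (\<Sum>n<N. sF (y n q) (x n)) \<in> ?V" for N
      unfolding J_sum by (intro G.span_sum G.span_scale G.span_base) auto
    then show "eventually (\<lambda>N. J (\<Sum>m<N. sE (b m p) (a m)) (\<Sum>n<N. sF (y n q) (x n)) \<in> closure ?V)
        sequentially"
      using closure_subset by (intro always_eventually) blast
  qed simp
  then have "j (tensor_sum sE sF ps) \<in> closure ?V" for ps
    unfolding j_tensor_sum
    by (induction ps) (auto intro: add zero)
  then have "j ` T \<subseteq> closure ?V" by (auto elim: T_cases)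
  then have "closure (j ` T) \<subseteq> closure ?V" by (rule closure_minimal) simp
  then show ?thesis by (auto simp: j_dense)
qed

lemma USB_square_ordering:
  "USB sG
    (\<lambda>k. case square_ordering k of (m, n) \<Rightarrow> J (a m) (x n))
    (\<lambda>k. case square_ordering k of (m, n) \<Rightarrow> ext_coeff m n)"
proof (rule G.USB_criterion[where C = 1])
  fix i k
  show "(case square_ordering k of (m, n) \<Rightarrow> ext_coeff m n) \<in> dual sG"
    by (simp add: case_prod_unfold ext_coeff_dual)
  have "square_ordering i = square_ordering k \<longleftrightarrow> i = k"
    using inj_square_ordering by (simp add: inj_eq)
  then show "(case square_ordering i of (m, n) \<Rightarrow> ext_coeff m n)
      (case square_ordering k of (m, n) \<Rightarrow> J (a m) (x n)) = (if i = k then 1 else 0)"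
    by (auto simp: case_prod_unfold ext_coeff_j elem_tensor_in_tensor_product coeff_basis prod_eq_iff)
next
  fix K :: "nat set" and z assume K: "finite K"
  have inj: "inj_on square_ordering K" using inj_square_ordering by (rule inj_on_subset) simp
  have "(\<Sum>k\<in>K. sG ((case square_ordering k of (m, n) \<Rightarrow> ext_coeff m n) z)
      (case square_ordering k of (m, n) \<Rightarrow> J (a m) (x n)))
    = (\<Sum>(m, n)\<in>square_ordering ` K. sG (ext_coeff m n z) (J (a m) (x n)))"
    by (simp add: sum.reindex[OF inj] case_prod_unfold)
  then show "norm (\<Sum>k\<in>K. sG ((case square_ordering k of (m, n) \<Rightarrow> ext_coeff m n) z)
      (case square_ordering k of (m, n) \<Rightarrow> J (a m) (x n))) \<le> 1 * norm z"
    using norm_ext_projection_le[of "square_ordering ` K" z] K by simp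
next
  have "range (\<lambda>k. case square_ordering k of (m, n) \<Rightarrow> J (a m) (x n))
      = (\<lambda>(m, n). J (a m) (x n)) ` range square_ordering" by (auto simp: image_image)
  then show "closure (G.span (range (\<lambda>k. case square_ordering k of (m, n) \<Rightarrow> J (a m) (x n)))) = UNIV"
    using closure_span_basis_tensors surj_square_ordering by simp
qed

end

section \<open>The tensor product basis\<close>

theorem theorem4:
  fixes sE :: "'k::{real_normed_field,euclidean_space} \<Rightarrow> 'a::banach \<Rightarrow> 'a"
    and sF :: "'k \<Rightarrow> 'b::banach \<Rightarrow> 'b"
    and sG :: "'k \<Rightarrow> 'c::banach \<Rightarrow> 'c"
    and a :: "nat \<Rightarrow> 'a" and b :: "nat \<Rightarrow> 'a \<Rightarrow> 'k"
    and x :: "nat \<Rightarrow> 'b" and y :: "nat \<Rightarrow> 'b \<Rightarrow> 'k"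
    and j :: "('k, 'a, 'b) tensor \<Rightarrow> 'c"
  assumes "normed_space_over sE" and "normed_space_over sF"
    and "USB sE a b" and "USB sF x y"
    and "tensor_completion sE sF (bess_norm sE sF a b x y) sG j"
  shows "USB sG
    (\<lambda>k. case square_ordering k of (m, n) \<Rightarrow> j (elem_tensor sE sF (a m) (x n)))
    (\<lambda>k. case square_ordering k of (m, n) \<Rightarrow>
      completion_extension (tensor_product sE sF) j (functional_tensor (b m) (y n)))"
proof -
  have "besselian_completion sE a b sF x y sG j"
    using assms by (simp add: besselian_completion_def unconditional_basis_def
        unconditional_basis_axioms_def besselian_completion_axioms_def)
  then show ?thesis by (rule besselian_completion.USB_square_ordering)
qed

end
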